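(* Let $H$ be a separable infinite dimensional complex Hilbert space and let $T\in B(H)$. There exists an orthonormal basis $\{b_j\}_{j=1}^\infty$ of $H$ with $\sum_{j=1}^\infty |(Tb_j,b_j)|<\infty$ if and only if there exists an orthonormal basis $\{e_j\}_{j=1}^\infty$ of $H$ (ordered by $\mathbb{N}$) for which the partial sums $\sum_{j=1}^n (Te_j,e_j)$ converge to some complex number as $n\to\infty$.
   Context: $(\cdot,\cdot)$ is the inner product of $H$. *)

theory Defs
  imports "HOL-Analysis.Analysis"
begin

text \<open>
  Complex inner product spaces, the inner product being linear in the first argument.
  The class extends \<open>real_inner\<close>, so that the norm and the topology are those of the library;
  since the real inner product is required to be the real part of the complex one, the norm is
  the one induced by the complex inner product (lemma \<open>cinner_self\<close>), and positive
  definiteness is inherited from \<open>real_inner\<close>.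
\<close>

class complex_inner = real_inner +
  fixes scaleC :: "complex \<Rightarrow> 'a \<Rightarrow> 'a"  (infixr "*\<^sub>C" 75)
    and cinner :: "'a \<Rightarrow> 'a \<Rightarrow> complex"
  assumes scaleC_add_right: "a *\<^sub>C (x + y) = a *\<^sub>C x + a *\<^sub>C y"
    and scaleC_add_left: "(a + b) *\<^sub>C x = a *\<^sub>C x + b *\<^sub>C x"
    and scaleC_scaleC: "a *\<^sub>C b *\<^sub>C x = (a * b) *\<^sub>C x"
    and scaleC_of_real: "complex_of_real r *\<^sub>C x = r *\<^sub>R x"
    and cinner_commute: "cinner x y = cnj (cinner y x)"
    and cinner_add_left: "cinner (x + y) z = cinner x z + cinner y z"
    and cinner_scaleC_left: "cinner (a *\<^sub>C x) y = a * cinner x y"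
    and Re_cinner: "Re (cinner x y) = x \<bullet> y"

class chilbert_space = complex_inner + complete_space

global_interpretation complex_vector:
  vector_space "scaleC :: complex \<Rightarrow> 'a \<Rightarrow> 'a::complex_inner"
  defines cspan = "complex_vector.span"
  by unfold_locales
    (simp_all add: scaleC_add_right scaleC_add_left scaleC_scaleC
      scaleC_of_real[of 1, simplified])

lemma cinner_self: "cinner x x = complex_of_real ((norm x)\<^sup>2)"
  for x :: "'a::complex_inner"
proof (rule complex_eqI)
  show "Re (cinner x x) = Re (complex_of_real ((norm x)\<^sup>2))"
    by (simp add: Re_cinner power2_norm_eq_inner del: of_real_power)
  have "Im (cinner x x) = - Im (cinner x x)"
    by (subst cinner_commute) simp
  then show "Im (cinner x x) = Im (complex_of_real ((norm x)\<^sup>2))"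
    by (simp del: of_real_power)
qed

instantiation complex :: chilbert_space
begin

definition scaleC_complex :: "complex \<Rightarrow> complex \<Rightarrow> complex"
  where "scaleC_complex a x = a * x"

definition cinner_complex :: "complex \<Rightarrow> complex \<Rightarrow> complex"
  where "cinner_complex x y = x * cnj y"

instance
  by standard
    (simp_all add: scaleC_complex_def cinner_complex_def algebra_simps inner_complex_def
      scaleR_conv_of_real)

end

definition infinite_cdim :: "'a::complex_inner itself \<Rightarrow> bool"
  where "infinite_cdim _ \<longleftrightarrow> \<not> (\<exists>B :: 'a set. finite B \<and> cspan B = UNIV)"

definition bounded_clinear :: "('a::complex_inner \<Rightarrow> 'b::complex_inner) \<Rightarrow> bool"
  where "bounded_clinear T \<longleftrightarrow>
    Vector_Spaces.linear scaleC scaleC T \<and> (\<exists>K. \<forall>x. norm (T x) \<le> K * norm x)"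

lemma bounded_clinear_imp_bounded_linear:
  assumes "bounded_clinear T"
  shows "bounded_linear T"
proof -
  from assms interpret Vector_Spaces.linear scaleC scaleC T
    by (simp add: bounded_clinear_def)
  obtain K where "\<And>x. norm (T x) \<le> K * norm x"
    using assms by (auto simp: bounded_clinear_def)
  then show ?thesis
    by (intro bounded_linear_intro[of T K])
      (auto simp: add scale mult.commute simp flip: scaleC_of_real)
qed

text \<open>The basis is ordered by the natural numbers, counted from \<open>0\<close>.\<close>

definition orthonormal_basis :: "(nat \<Rightarrow> 'a::complex_inner) \<Rightarrow> bool"
  where "orthonormal_basis b \<longleftrightarrow>
    (\<forall>i j. cinner (b i) (b j) = (if i = j then 1 else 0)) \<and>
    closure (cspan (range b)) = UNIV"

end

theory Submission
  imports Defs
begin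

text \<open>
  Every point of the segment between two diagonal entries \<open>(Tu, u)\<close> and \<open>(Tv, v)\<close> is a diagonal
  entry after a rotation in the plane of \<open>u\<close> and \<open>v\<close>, and such a rotation preserves the sum of the
  two entries. Iterating this inside a finite block of basis vectors makes the diagonal of the
  block constant (Parker), so that the sum of the absolute values over the block becomes the
  absolute value of the sum. If the partial sums converge, the basis can be cut into consecutive
  finite blocks whose sums have summable absolute values.
\<close>

section \<open>Conjugate linearity and orthogonality to spans\<close>

lemma cinner_zero_left [simp]: "cinner 0 y = 0"
  for y :: "'a::complex_inner"
  using cinner_add_left[of 0 0 y] by simp

lemma cinner_add_right: "cinner x (y + z) = cinner x y + cinner x z"
  for x :: "'a::complex_inner"
  by (metis cinner_add_left cinner_commute complex_cnj_add)

lemma cinner_scaleC_right: "cinner x (a *\<^sub>C y) = cnj a * cinner x y"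
  for x :: "'a::complex_inner"
  by (metis cinner_commute cinner_scaleC_left complex_cnj_mult)

lemma cinner_cspan_eq_0:
  fixes S :: "'a::complex_inner set"
  assumes "x \<in> cspan S" and "\<And>s. s \<in> S \<Longrightarrow> cinner s y = 0"
  shows "cinner x y = 0"
  using assms(1)
  by (induction rule: complex_vector.span_induct_alt)
    (auto simp: cinner_add_left cinner_scaleC_left assms(2))

section \<open>Orthonormal sequences changed on a set of indices\<close>

definition orthonormal :: "(nat \<Rightarrow> 'a::complex_inner) \<Rightarrow> bool"
  where "orthonormal f \<longleftrightarrow> (\<forall>i j. cinner (f i) (f j) = (if i = j then 1 else 0))"

text \<open>When \<open>f\<close> is orthonormal, \<open>T\<close> linear and \<open>I\<close>
  finite, this is a change of orthonormal basis in the span of one block. The span clause later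
  carries density over to the new sequence; the sum clause is the invariance of the trace of the
  compression of \<open>T\<close> to that span.\<close>

definition rotated_on ::
    "('a \<Rightarrow> 'a) \<Rightarrow> nat set \<Rightarrow> (nat \<Rightarrow> 'a) \<Rightarrow> (nat \<Rightarrow> 'a::complex_inner) \<Rightarrow> bool"
  where "rotated_on T I f g \<longleftrightarrow> orthonormal g \<and> (\<forall>i. i \<notin> I \<longrightarrow> g i = f i) \<and>
    cspan (g ` I) = cspan (f ` I) \<and>
    (\<Sum>i\<in>I. cinner (T (g i)) (g i)) = (\<Sum>i\<in>I. cinner (T (f i)) (f i))"

lemma rotated_on_refl: "orthonormal f \<Longrightarrow> rotated_on T I f f"
  by (simp add: rotated_on_def)

lemma rotated_on_trans:
  "rotated_on T I f g \<Longrightarrow> rotated_on T I g h \<Longrightarrow> rotated_on T I f h"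
  by (simp add: rotated_on_def)

text \<open>Passing from \<open>I\<close> to \<open>J\<close> adds the same vectors to both spans
  and the same terms to both sums. Thus a rotation of two vectors counts as a rotation of any finite
  block that contains them.\<close>

lemma rotated_on_mono:
  assumes "rotated_on T I f g" "I \<subseteq> J" "finite J"
  shows "rotated_on T J f g"
proof -
  have outside: "g i = f i" if "i \<notin> I" for i
    using assms(1) that by (simp add: rotated_on_def)
  have I: "g ` I \<subseteq> cspan (f ` I)" "f ` I \<subseteq> cspan (g ` I)"
    using assms(1) complex_vector.span_superset unfolding rotated_on_def by metis+
  have "cspan (f ` I) \<subseteq> cspan (f ` J)" "cspan (g ` I) \<subseteq> cspan (g ` J)"
    using assms(2) by (simp_all add: complex_vector.span_mono image_mono)
  with I have in_I: "g i \<in> cspan (f ` J)" "f i \<in> cspan (g ` J)" if "i \<in> I" for i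
    using that by blast+
  have base: "h i \<in> cspan (h ` J)" if "i \<in> J" for h :: "nat \<Rightarrow> 'a" and i
    by (rule complex_vector.span_base) (use that in blast)
  have "g i \<in> cspan (f ` J)" "f i \<in> cspan (g ` J)" if "i \<in> J" for i
    using in_I[of i] base[OF that] outside[of i] by metis+
  then have "cspan (g ` J) = cspan (f ` J)"
    unfolding complex_vector.span_eq by auto
  moreover have "(\<Sum>i\<in>J. cinner (T (g i)) (g i)) = (\<Sum>i\<in>J. cinner (T (f i)) (f i))"
    using assms outside
    by (simp add: rotated_on_def sum.subset_diff[OF assms(2,3)])
  ultimately show ?thesis
    using assms(1,2) by (auto simp: rotated_on_def)
qed

section \<open>Rotations in a plane\<close>

text \<open>Let \<open>w\<close> be a unimodular multiple of \<open>v\<close> and x = c u + s w. The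
  entry at \<open>x\<close> is c^2 \<alpha> + s^2 \<beta> + c s C. Once \<open>C\<close> is a real
  multiple of \<beta> - \<alpha>, this entry moves on the line through \<alpha> and \<beta> as the
  angle varies, and the intermediate value theorem makes it hit \<open>p\<close>.\<close>

lemma rotate_two:
  fixes T :: "'a::complex_inner \<Rightarrow> 'a"
  assumes T: "Vector_Spaces.linear scaleC scaleC T"
    and uv: "cinner u u = 1" "cinner v v = 1" "cinner u v = 0"
    and p: "p \<in> closed_segment (cinner (T u) u) (cinner (T v) v)"
  obtains x y where "cinner x x = 1" "cinner y y = 1" "cinner x y = 0"
    "cspan {x, y} = cspan {u, v}" "cinner (T x) x = p"
    "cinner (T x) x + cinner (T y) y = cinner (T u) u + cinner (T v) v"
proof -
  interpret T: Vector_Spaces.linear scaleC scaleC T by (fact T)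
  define \<alpha> where "\<alpha> = cinner (T u) u"
  define \<beta> where "\<beta> = cinner (T v) v"
  obtain t where t: "0 \<le> t" "t \<le> 1" and p_eq: "p = (1 - t) *\<^sub>R \<alpha> + t *\<^sub>R \<beta>"
    using p by (auto simp: in_segment \<alpha>_def \<beta>_def)
  have vu: "cinner v u = 0"
    using uv(3) by (subst cinner_commute) simp
  \<comment> \<open>Since Im (cnj \<omega> * q) = - Im (\<omega> * cnj q), the two cross terms,
    multiplied by \<open>cnj (\<beta> - \<alpha>)\<close>, have together the imaginary part of
    \<open>\<omega> * z\<close>.\<close>
  define z where
    "z = cinner (T v) u * cnj (\<beta> - \<alpha>) - cnj (cinner (T u) v * cnj (\<beta> - \<alpha>))"
  \<comment> \<open>This phase makes the cross term a real multiple of \<open>\<beta> - \<alpha>\<close>.\<close>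
  define \<omega> where "\<omega> = (if z = 0 then 1 else cnj z / cmod z)"
  have \<omega>: "\<omega> * cnj \<omega> = 1"
    by (simp add: \<omega>_def norm_divide flip: complex_norm_square)
  have "\<omega> * z \<in> \<real>"
    by (auto simp: \<omega>_def complex_norm_square[symmetric] mult.commute[of "cnj z"])
  define w where "w = \<omega> *\<^sub>C v"
  define C where "C = cinner (T w) u + cinner (T u) w"
  have w: "cinner w w = 1" "cinner u w = 0" "cinner w u = 0" "cinner (T w) w = \<beta>"
    using \<omega> mult.commute[of "cnj \<omega>" \<omega>] uv vu
    by (simp_all add: w_def cinner_scaleC_left cinner_scaleC_right T.scale \<beta>_def mult.assoc[symmetric])
  have C_eq: "C = \<omega> * cinner (T v) u + cnj \<omega> * cinner (T u) v"
    by (simp add: C_def w_def cinner_scaleC_left cinner_scaleC_right T.scale)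
  have "Im (C * cnj (\<beta> - \<alpha>)) = Im (\<omega> * z)"
    by (simp add: C_eq z_def algebra_simps)
  then have "Im (C * cnj (\<beta> - \<alpha>)) = 0"
    using \<open>\<omega> * z \<in> \<real>\<close> by (simp add: complex_is_Real_iff)
  then obtain r' :: real where r': "C * cnj (\<beta> - \<alpha>) = r'"
    by (metis complex_is_Real_iff Reals_cases)
  have "\<exists>c s. complex_of_real c * complex_of_real c + complex_of_real s * complex_of_real s = 1 \<and>
    complex_of_real c * complex_of_real c * \<alpha> + complex_of_real s * complex_of_real s * \<beta>
      + complex_of_real c * complex_of_real s * C = p"
  proof (cases "\<alpha> = \<beta>")
    \<comment> \<open>The segment is a single point, attained at angle zero.\<close>
    case True
    then show ?thesis
      by (intro exI[of _ 1] exI[of _ 0]) (simp add: p_eq scaleR_conv_of_real algebra_simps)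
  next
    case False
    \<comment> \<open>Multiplying \<open>C * cnj (\<beta> - \<alpha>) = r'\<close> by \<beta> -
      \<alpha> shows that this is the real ratio of \<open>C\<close> to \<beta> - \<alpha>.\<close>
    define r where "r = r' / (cmod (\<beta> - \<alpha>))\<^sup>2"
    have "C * complex_of_real ((cmod (\<beta> - \<alpha>))\<^sup>2) = r' * (\<beta> - \<alpha>)"
      unfolding complex_norm_square by (metis r' mult.assoc mult.commute)
    then have C: "C = r * (\<beta> - \<alpha>)"
      using False by (simp add: r_def divide_simps)
    \<comment> \<open>The expression is 0 at angle 0 and 1 at \<open>pi / 2\<close>, and
      \<open>t\<close> lies in between.\<close>
    have "\<exists>\<theta>\<ge>0. \<theta> \<le> pi / 2 \<and> (sin \<theta>)\<^sup>2 + cos \<theta> * sin \<theta> * r = t"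
      by (rule IVT') (use t in \<open>auto intro!: continuous_intros\<close>)
    then obtain c s :: real where "c * c + s * s = 1" "s * s + c * s * r = t"
      using sin_cos_squared_add2[folded power2_eq_square] by (metis power2_eq_square)
    then have cs: "complex_of_real c * complex_of_real c + complex_of_real s * complex_of_real s = 1"
      "complex_of_real s * complex_of_real s + complex_of_real c * complex_of_real s * r = t"
      by (metis of_real_1 of_real_add of_real_mult)+
    have "complex_of_real c * complex_of_real c * \<alpha> + complex_of_real s * complex_of_real s * \<beta>
          + complex_of_real c * complex_of_real s * C
        = (complex_of_real c * complex_of_real c + complex_of_real s * complex_of_real s) * \<alpha>
          + (complex_of_real s * complex_of_real s + complex_of_real c * complex_of_real s * r)
            * (\<beta> - \<alpha>)"
      by (simp add: C algebra_simps)
    also have "\<dots> = p"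
      unfolding cs by (simp add: p_eq scaleR_conv_of_real algebra_simps)
    finally show ?thesis
      using cs(1) by blast
  qed
  then obtain c s :: real
    where cs: "complex_of_real c * complex_of_real c + complex_of_real s * complex_of_real s = 1"
    and cs_p: "complex_of_real c * complex_of_real c * \<alpha> + complex_of_real s * complex_of_real s * \<beta>
      + complex_of_real c * complex_of_real s * C = p"
    by blast
  define x where "x = complex_of_real c *\<^sub>C u + complex_of_real s *\<^sub>C w"
  \<comment> \<open>The unit vector of the plane orthogonal to \<open>x\<close>. Its cross term is -
    c s C and cancels that of \<open>x\<close> in the sum of the two entries.\<close>
  define y where "y = complex_of_real (- s) *\<^sub>C u + complex_of_real c *\<^sub>C w"
  have quad: "cinner (T (a *\<^sub>C u + b *\<^sub>C w)) (a *\<^sub>C u + b *\<^sub>C w)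
      = a * cnj a * \<alpha> + b * cnj b * \<beta> + (a * cnj b * cinner (T u) w + b * cnj a * cinner (T w) u)"
    for a b
    unfolding w(4)[symmetric] \<alpha>_def
    by (simp add: T.add T.scale cinner_add_left cinner_add_right cinner_scaleC_left
        cinner_scaleC_right distrib_left mult_ac add_ac)
  have Tx: "cinner (T x) x = p"
    unfolding x_def quad cs_p[symmetric] C_def by (simp add: algebra_simps)
  have "cinner (T x) x + cinner (T y) y
      = (complex_of_real c * complex_of_real c + complex_of_real s * complex_of_real s) * (\<alpha> + \<beta>)"
    unfolding x_def y_def quad by (simp add: algebra_simps)
  then have sum: "cinner (T x) x + cinner (T y) y = \<alpha> + \<beta>"
    unfolding cs by simp
  have "cinner (a *\<^sub>C u + b *\<^sub>C w) (a' *\<^sub>C u + b' *\<^sub>C w) = a * cnj a' + b * cnj b'" for a b a' b'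
    using w uv by (simp add: cinner_add_left cinner_add_right cinner_scaleC_left cinner_scaleC_right)
  then have orth: "cinner x x = 1" "cinner y y = 1" "cinner x y = 0"
    unfolding x_def y_def using cs by (simp_all only:) (simp_all add: add.commute)
  have v: "v = cnj \<omega> *\<^sub>C w"
    unfolding w_def scaleC_scaleC mult.commute[of "cnj \<omega>"] \<omega> by simp
  \<comment> \<open>The inverse rotation recovers \<open>u\<close> and \<open>w\<close>, which gives
    the other inclusion between the spans.\<close>
  have u_eq: "u = complex_of_real c *\<^sub>C x + complex_of_real (- s) *\<^sub>C y"
  proof -
    have "complex_of_real c *\<^sub>C x + complex_of_real (- s) *\<^sub>C y
      = (complex_of_real c * c + complex_of_real s * s) *\<^sub>C u
        + (complex_of_real c * s + complex_of_real (- s) * c) *\<^sub>C w"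
      by (simp only: x_def y_def scaleC_add_right scaleC_add_left scaleC_scaleC)
        (simp add: algebra_simps)
    then show ?thesis unfolding cs by (simp add: mult.commute)
  qed
  have w_eq: "w = complex_of_real s *\<^sub>C x + complex_of_real c *\<^sub>C y"
  proof -
    have "complex_of_real s *\<^sub>C x + complex_of_real c *\<^sub>C y
      = (complex_of_real s * c + complex_of_real c * (- s)) *\<^sub>C u
        + (complex_of_real c * c + complex_of_real s * s) *\<^sub>C w"
      by (simp only: x_def y_def scaleC_add_right scaleC_add_left scaleC_scaleC)
        (simp add: algebra_simps)
    then show ?thesis unfolding cs by (simp add: mult.commute)
  qed
  have comb: "a *\<^sub>C m + b *\<^sub>C n \<in> cspan S"
    if "m \<in> cspan S" "n \<in> cspan S" for a b m n and S :: "'a set"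
    using that by (intro complex_vector.span_add complex_vector.span_scale)
  have base: "m \<in> cspan {m, n}" "n \<in> cspan {m, n}" for m n :: 'a
    by (simp_all add: complex_vector.span_base)
  have "w \<in> cspan {u, v}"
    unfolding w_def by (rule complex_vector.span_scale[OF base(2)])
  then have xy_in: "x \<in> cspan {u, v}" "y \<in> cspan {u, v}"
    unfolding x_def y_def by (simp_all only: comb base)
  have "u \<in> cspan {x, y}" "w \<in> cspan {x, y}"
    by (subst u_eq, rule comb[OF base]) (subst w_eq, rule comb[OF base])
  then have "v \<in> cspan {x, y}"
    by (subst v) (rule complex_vector.span_scale)
  then have span: "cspan {x, y} = cspan {u, v}"
    using xy_in \<open>u \<in> cspan {x, y}\<close> unfolding complex_vector.span_eq by blast
  show ?thesis
    by (rule that[OF orth span Tx]) (use sum in \<open>simp only: \<alpha>_def \<beta>_def\<close>)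
qed

text \<open>The rotated pair stays in the span of \<open>f i\<close> and \<open>f j\<close>, hence
  orthogonal to all other vectors of \<open>f\<close>, and can be substituted for the old
  pair.\<close>

lemma rotated_on_segment:
  fixes T :: "'a::complex_inner \<Rightarrow> 'a"
  assumes T: "Vector_Spaces.linear scaleC scaleC T" and f: "orthonormal f" and "i \<noteq> j"
    and "p \<in> closed_segment (cinner (T (f i)) (f i)) (cinner (T (f j)) (f j))"
  obtains g where "rotated_on T {i, j} f g" "cinner (T (g i)) (g i) = p"
proof -
  have ij: "cinner (f i) (f i) = 1" "cinner (f j) (f j) = 1" "cinner (f i) (f j) = 0"
    using f \<open>i \<noteq> j\<close> by (auto simp: orthonormal_def)
  obtain x y where xy: "cinner x x = 1" "cinner y y = 1" "cinner x y = 0"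
    and span: "cspan {x, y} = cspan {f i, f j}" and x: "cinner (T x) x = p"
    and sum: "cinner (T x) x + cinner (T y) y
      = cinner (T (f i)) (f i) + cinner (T (f j)) (f j)"
    using rotate_two[OF T ij assms(4)] by blast
  define g where "g = f(i := x, j := y)"
  have g: "g i = x" "g j = y" "\<And>k. k \<noteq> i \<Longrightarrow> k \<noteq> j \<Longrightarrow> g k = f k"
    using \<open>i \<noteq> j\<close> by (auto simp: g_def)
  have yx: "cinner y x = 0"
    using xy(3) by (subst cinner_commute) simp
  have "cinner z (f k) = 0" if "z \<in> {x, y}" "k \<noteq> i" "k \<noteq> j" for z k
  proof (rule cinner_cspan_eq_0)
    show "z \<in> cspan {f i, f j}"
      using that(1) complex_vector.span_base[of z "{x, y}"] by (simp only: span)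
  qed (use that f in \<open>auto simp: orthonormal_def\<close>)
  then have 1: "cinner z (f k) = 0" "cinner (f k) z = 0" if "z \<in> {x, y}" "k \<noteq> i" "k \<noteq> j" for z k
    using that by (blast, metis cinner_commute complex_cnj_zero)
  have "orthonormal g"
    unfolding orthonormal_def
  proof (intro allI)
    fix k l
    show "cinner (g k) (g l) = (if k = l then 1 else 0)"
      using f xy yx 1 g(1,2) g(3)[of k] g(3)[of l]
      by (cases "k = i"; cases "k = j"; cases "l = i"; cases "l = j")
        (auto simp: orthonormal_def)
  qed
  then have "rotated_on T {i, j} f g"
    using span sum \<open>i \<noteq> j\<close> g by (simp add: rotated_on_def)
  with that x g show ?thesis by blast
qed

section \<open>Prescribing diagonal entries in a finite block\<close>

text \<open>A point of the hull over \<open>insert k J\<close> lies on a segment from the entry at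
  \<open>k\<close> to a point \<open>q\<close> of the hull over \<open>J\<close>. By induction a
  rotation inside \<open>J\<close> makes \<open>q\<close> an entry at some \<open>j\<close> while
  leaving the vector at \<open>k\<close> alone; one rotation in the plane of \<open>k\<close> and
  \<open>j\<close> then reaches \<open>p\<close>.\<close>

lemma rotated_on_convex_hull:
  fixes T :: "'a::complex_inner \<Rightarrow> 'a"
  assumes T: "Vector_Spaces.linear scaleC scaleC T" and f: "orthonormal f"
    and "finite I" "I \<noteq> {}" "p \<in> convex hull ((\<lambda>i. cinner (T (f i)) (f i)) ` I)"
  shows "\<exists>g. rotated_on T I f g \<and> (\<exists>i\<in>I. cinner (T (g i)) (g i) = p)"
  using assms(3-)
proof (induction I arbitrary: p rule: finite_ne_induct)
  case (singleton i)
  then show ?case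
    using rotated_on_refl[OF f] by auto
next
  case (insert k J)
  let ?d = "\<lambda>i. cinner (T (f i)) (f i)"
  obtain u v q where uv: "0 \<le> u" "0 \<le> v" "u + v = 1" and q: "q \<in> convex hull (?d ` J)"
    and p: "p = u *\<^sub>R ?d k + v *\<^sub>R q"
    using insert.prems insert.hyps by (auto simp: convex_hull_insert)
  obtain g j where g: "rotated_on T J f g" and j: "j \<in> J" and gj: "cinner (T (g j)) (g j) = q"
    using insert.IH[OF q] by blast
  have gk: "g k = f k" and "orthonormal g" "k \<noteq> j"
    using g j \<open>k \<notin> J\<close> by (auto simp: rotated_on_def)
  have "p \<in> closed_segment (cinner (T (g k)) (g k)) (cinner (T (g j)) (g j))"
  proof -
    have "u = 1 - v"
      using uv(3) by simp
    then show ?thesis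
      using uv p gj gk by (auto simp: closed_segment_def intro!: exI[of _ v])
  qed
  then obtain h where h: "rotated_on T {k, j} g h" "cinner (T (h k)) (h k) = p"
    using rotated_on_segment[OF T \<open>orthonormal g\<close> \<open>k \<noteq> j\<close>] by blast
  have "rotated_on T (insert k J) f h"
    by (rule rotated_on_trans; rule rotated_on_mono)
      (use g h j insert.hyps in auto)
  with h show ?case by blast
qed

text \<open>The mean \<open>m\<close> of the entries lies in their convex hull, so a rotation puts
  it at one index \<open>i\<close>. The induction then continues on the remaining indices with the
  rotated sequence.\<close>

lemma rotated_on_constant_diagonal:
  fixes T :: "'a::complex_inner \<Rightarrow> 'a"
  assumes T: "Vector_Spaces.linear scaleC scaleC T" and f: "orthonormal f" and "finite I"
    and "(\<Sum>i\<in>I. cinner (T (f i)) (f i)) = of_nat (card I) * m"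
  shows "\<exists>g. rotated_on T I f g \<and> (\<forall>i\<in>I. cinner (T (g i)) (g i) = m)"
  using assms(2-)
proof (induction "card I" arbitrary: I f)
  case 0
  then show ?case
    using rotated_on_refl[OF 0(2)] by auto
next
  case (Suc n)
  let ?d = "\<lambda>i. cinner (T (f i)) (f i)"
  have I: "I \<noteq> {}" "card I > 0"
    using Suc.hyps(2) by auto
  have "(\<Sum>i\<in>I. (1 / card I) *\<^sub>R ?d i) \<in> convex hull (?d ` I)"
    by (rule convex_sum) (use Suc.prems I in \<open>auto simp: hull_inc\<close>)
  also have "(\<Sum>i\<in>I. (1 / card I) *\<^sub>R ?d i) = m"
    unfolding scaleR_sum_right[symmetric] Suc.prems(3)
    using I Suc.prems(2) by (simp add: scaleR_conv_of_real)
  finally obtain g i where g: "rotated_on T I f g" and i: "i \<in> I" "cinner (T (g i)) (g i) = m"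
    using rotated_on_convex_hull[OF T Suc.prems(1,2) I(1)] by blast
  have card: "n = card (I - {i})"
    using Suc.hyps(2) Suc.prems(2) i by simp
  \<comment> \<open>The total is unchanged, so removing one entry \<open>m\<close> leaves a block
    whose mean is again \<open>m\<close>.\<close>
  have "of_nat (card I) * m = m + (\<Sum>i\<in>I - {i}. cinner (T (g i)) (g i))"
    using g Suc.prems i by (simp add: rotated_on_def sum.remove)
  then have "(\<Sum>i\<in>I - {i}. cinner (T (g i)) (g i)) = of_nat (card (I - {i})) * m"
    by (simp add: card[symmetric] Suc.hyps(2)[symmetric] algebra_simps)
  then obtain h where h: "rotated_on T (I - {i}) g h"
      "\<forall>k\<in>I - {i}. cinner (T (h k)) (h k) = m"
    using Suc.hyps(1)[OF card, of g] g Suc.prems(2) by (auto simp: rotated_on_def)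
  have "h i = g i"
    using h(1) by (simp add: rotated_on_def)
  then have "\<forall>k\<in>I. cinner (T (h k)) (h k) = m"
    using h(2) i by auto
  moreover have "rotated_on T I f h"
    using g rotated_on_mono[OF h(1), of I] Suc.prems(2) by (auto intro: rotated_on_trans)
  ultimately show ?case by blast
qed

section \<open>Absolutely summable and conditionally summable diagonals\<close>

theorem proposition2p12:
  fixes T :: "'a::chilbert_space \<Rightarrow> 'a"
  assumes "separable_space (euclidean :: 'a topology)"
    and "infinite_cdim TYPE('a)"
    and "bounded_clinear T"
  shows "(\<exists>b. orthonormal_basis b \<and> summable (\<lambda>j. cmod (cinner (T (b j)) (b j)))) \<longleftrightarrow>
    (\<exists>e. orthonormal_basis e \<and>
      (\<exists>s::complex. (\<lambda>n. \<Sum>j<n. cinner (T (e j)) (e j)) \<longlonglongrightarrow> s))"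
proof
  assume "\<exists>b. orthonormal_basis b \<and> summable (\<lambda>j. cmod (cinner (T (b j)) (b j)))"
  then obtain b where "orthonormal_basis b" "summable (\<lambda>j. cmod (cinner (T (b j)) (b j)))"
    by blast
  \<comment> \<open>Absolute convergence implies convergence, so the same basis serves.\<close>
  then show "\<exists>e. orthonormal_basis e \<and>
      (\<exists>s::complex. (\<lambda>n. \<Sum>j<n. cinner (T (e j)) (e j)) \<longlonglongrightarrow> s)"
    by (intro exI[of _ b] conjI exI) (auto intro!: summable_LIMSEQ summable_norm_cancel)
next
  assume "\<exists>e. orthonormal_basis e \<and>
      (\<exists>s::complex. (\<lambda>n. \<Sum>j<n. cinner (T (e j)) (e j)) \<longlonglongrightarrow> s)"
  then obtain e s where e: "orthonormal_basis e"
    and s: "(\<lambda>n. \<Sum>j<n. cinner (T (e j)) (e j)) \<longlonglongrightarrow> s"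
    by blast
  have T: "Vector_Spaces.linear scaleC scaleC T"
    using assms(3) by (simp add: bounded_clinear_def)
  have orth_e: "orthonormal e"
    using e by (simp add: orthonormal_basis_def orthonormal_def)
  define S where "S n = (\<Sum>j<n. cinner (T (e j)) (e j))" for n
  have "S \<longlonglongrightarrow> s"
    using s by (simp add: S_def[abs_def])
  have step: "\<exists>m>n. cmod (S m - s) < (1 / 2) ^ k" for n k
  proof -
    obtain N where "\<forall>m\<ge>N. cmod (S m - s) < (1 / 2) ^ k"
      using LIMSEQ_D[OF \<open>S \<longlonglongrightarrow> s\<close>, of "(1 / 2) ^ k"] by auto
    then show ?thesis
      by (intro exI[of _ "max N (Suc n)"]) auto
  qed
  \<comment> \<open>The cuts start at 0 so that the blocks cover all indices; closeness to
    \<open>s\<close> is demanded only from the second cut on. Strict growth makes every block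
    nonempty, hence the division in \<open>m\<close> below legitimate.\<close>
  have "\<exists>n. \<forall>k. (k = 0 \<longrightarrow> n k = (0::nat)) \<and>
      n k < n (Suc k) \<and> cmod (S (n (Suc k)) - s) < (1 / 2) ^ k"
    by (rule dependent_nat_choice) (use step in \<open>auto\<close>)
  then obtain n :: "nat \<Rightarrow> nat" where n0: "n 0 = 0" and n_less: "\<And>k. n k < n (Suc k)"
    and n_close: "\<And>k. cmod (S (n (Suc k)) - s) < (1 / 2) ^ k"
    by metis
  have mono_n: "strict_mono n"
    using n_less by (simp add: strict_mono_Suc_iff)
  define I where "I k = {n k..<n (Suc k)}" for k
  define m where "m k = (\<Sum>i\<in>I k. cinner (T (e i)) (e i)) / of_nat (card (I k))" for k
  have "(\<Sum>i\<in>I k. cinner (T (e i)) (e i)) = of_nat (card (I k)) * m k" for k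
    using n_less[of k] by (simp add: m_def I_def)
  then have "\<exists>g. rotated_on T (I k) e g \<and> (\<forall>i\<in>I k. cinner (T (g i)) (g i) = m k)" for k
    using rotated_on_constant_diagonal[OF T orth_e] by (simp add: I_def)
  then obtain g where g: "\<And>k. rotated_on T (I k) e (g k)"
    and g_diag: "\<And>k i. i \<in> I k \<Longrightarrow> cinner (T (g k i)) (g k i) = m k"
    by metis
  have disj: "k = l" if "i \<in> I k" "i \<in> I l" for i k l
  proof (rule ccontr)
    assume "k \<noteq> l"
    then have "Suc k \<le> l \<or> Suc l \<le> k" by auto
    then have "n (Suc k) \<le> n l \<or> n (Suc l) \<le> n k"
      using strict_mono_less_eq[OF mono_n] by blast
    with that show False by (auto simp: I_def)
  qed
  have "\<exists>k. i \<in> I k" for i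
  proof -
    have "i < n (Suc i)"
      using strict_mono_imp_increasing[OF mono_n, of "Suc i"] by simp
    \<comment> \<open>Minimality of \<open>k\<close> gives \<open>n k \<le> i\<close>; for
      \<open>k = 0\<close> this is \<open>n 0 = 0\<close>.\<close>
    then obtain k where "i < n (Suc k)" "\<forall>l<k. \<not> i < n (Suc l)"
      using exists_least_iff[of "\<lambda>k. i < n (Suc k)"] by blast
    then show ?thesis
      using n0 by (intro exI[of _ k]) (cases k; auto simp: I_def not_less)
  qed
  then obtain \<kappa> where \<kappa>: "\<And>i. i \<in> I (\<kappa> i)"
    by metis
  have \<kappa>_eq: "\<kappa> i = k" if "i \<in> I k" for i k
    using disj \<kappa> that by blast
  \<comment> \<open>Each \<open>g k\<close> rotates only its own block of \<open>e\<close>;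
    \<open>b\<close> takes from each the vectors of that block.\<close>
  define b where "b i = g (\<kappa> i) i" for i
  have b_image: "b ` I k = g k ` I k" for k
    using \<kappa>_eq by (auto simp: b_def)
  have b_span: "b i \<in> cspan (e ` I (\<kappa> i))" for i
    using g[of "\<kappa> i"] \<kappa>[of i] complex_vector.span_base[of "b i" "g (\<kappa> i) ` I (\<kappa> i)"]
    by (simp add: rotated_on_def b_def)
  have e_e: "cinner y (e j) = 0" if "y \<in> cspan (e ` I k)" "j \<notin> I k" for y j k
    using that(1)
    by (rule cinner_cspan_eq_0) (use orth_e that(2) in \<open>auto simp: orthonormal_def\<close>)
  have orth_b: "cinner (b i) (b j) = (if i = j then 1 else 0)" for i j
  proof (cases "\<kappa> i = \<kappa> j")
    case True
    then show ?thesis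
      using g[of "\<kappa> i"] by (simp add: b_def rotated_on_def orthonormal_def)
  next
    case False
    \<comment> \<open>Vectors of different blocks lie in spans of disjoint parts of
      \<open>e\<close>: \<open>b i\<close> is orthogonal to each \<open>e l\<close> of the other
      block, hence to \<open>b j\<close>.\<close>
    have "cinner (b j) (b i) = 0"
    proof (rule cinner_cspan_eq_0[OF b_span])
      fix y assume "y \<in> e ` I (\<kappa> j)"
      then obtain l where "l \<in> I (\<kappa> j)" "y = e l" by blast
      then have "cinner (b i) y = 0"
        using e_e[OF b_span, of l i] disj False by metis
      then show "cinner y (b i) = 0"
        by (subst cinner_commute) simp
    qed
    then show ?thesis
      using False by (subst cinner_commute) auto
  qed
  \<comment> \<open>Each rotation keeps the span of its block, so the span of \<open>b\<close>
    contains that of \<open>e\<close> and is dense.\<close>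
  have "e i \<in> cspan (range b)" for i
  proof -
    have "e i \<in> cspan (b ` I (\<kappa> i))"
      using g[of "\<kappa> i"] \<kappa>[of i] complex_vector.span_base[of "e i" "e ` I (\<kappa> i)"]
      by (simp add: rotated_on_def b_image)
    then show ?thesis
      using complex_vector.span_mono[of "b ` I (\<kappa> i)" "range b"] by blast
  qed
  then have "cspan (range e) \<subseteq> cspan (range b)"
    by (intro complex_vector.span_minimal) auto
  then have "closure (cspan (range b)) = UNIV"
    using e closure_mono unfolding orthonormal_basis_def by blast
  with orth_b have "orthonormal_basis b"
    by (simp add: orthonormal_basis_def)
  define a where "a k = cmod (S (n k) - s)" for k
  \<comment> \<open>The bound \<open>(1 / 2) ^ k\<close> belongs to the cut
    \<open>n (Suc k)\<close>, so the comparison concerns the shifted sequence; \<open>a 0\<close> is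
    one further term.\<close>
  have "summable (\<lambda>k. a (Suc k))"
    by (rule summable_comparison_test'[of "\<lambda>k. (1 / 2) ^ k" 0])
      (use n_close in \<open>auto simp: a_def less_imp_le\<close>)
  then have "summable a"
    by (simp add: summable_Suc_iff)
  with \<open>summable (\<lambda>k. a (Suc k))\<close> have sum_a: "summable (\<lambda>k. a (Suc k) + a k)"
    by (rule summable_add)
  let ?d = "\<lambda>j. cmod (cinner (T (b j)) (b j))"
  have block: "(\<Sum>j\<in>I k. ?d j) \<le> a (Suc k) + a k" for k
  proof -
    have "card (I k) > 0"
      using n_less[of k] by (simp add: I_def)
    \<comment> \<open>On a constant diagonal the triangle inequality is an equality: the sum of
      absolute values is the absolute value of the block sum, a difference of two partial sums near
      \<open>s\<close>.\<close>
    have "(\<Sum>j\<in>I k. ?d j) = (\<Sum>j\<in>I k. cmod (m k))"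
      by (rule sum.cong) (auto simp: b_def \<kappa>_eq g_diag)
    also have "\<dots> = cmod (\<Sum>i\<in>I k. cinner (T (e i)) (e i))"
      using \<open>card (I k) > 0\<close> by (simp add: m_def norm_divide)
    also have "(\<Sum>i\<in>I k. cinner (T (e i)) (e i)) = S (n (Suc k)) - S (n k)"
      using sum_diff_nat_ivl[of 0 "n k" "n (Suc k)" "\<lambda>i. cinner (T (e i)) (e i)"] n_less[of k]
      by (simp add: S_def I_def atLeast0LessThan)
    also have "cmod \<dots> \<le> a (Suc k) + a k"
      unfolding a_def using norm_triangle_ineq4[of "S (n (Suc k)) - s" "S (n k) - s"] by simp
    finally show ?thesis .
  qed
  have blocks: "(\<Sum>j<n k. ?d j) = (\<Sum>l<k. \<Sum>j\<in>I l. ?d j)" for k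
  proof (induction k)
    case (Suc k)
    then show ?case
      using sum.atLeastLessThan_concat[of 0 "n k" "n (Suc k)" ?d] n_less[of k]
      by (simp add: I_def atLeast0LessThan)
  qed (simp add: n0)
  have "summable ?d"
  proof (rule bounded_imp_summable)
    fix N
    \<comment> \<open>Strict growth gives \<open>k \<le> n k\<close>, so the first
      \<open>Suc N\<close> blocks contain all indices up to \<open>N\<close>.\<close>
    have "N < n (Suc N)"
      using strict_mono_imp_increasing[OF mono_n, of "Suc N"] by simp
    then have "(\<Sum>j\<le>N. ?d j) \<le> (\<Sum>j<n (Suc N). ?d j)"
      by (intro sum_mono2) auto
    also have "\<dots> \<le> (\<Sum>l<Suc N. a (Suc l) + a l)"
      unfolding blocks by (intro sum_mono block)
    also have "\<dots> \<le> (\<Sum>l. a (Suc l) + a l)"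
      by (rule sum_le_suminf[OF sum_a]) (auto simp: a_def)
    finally show "(\<Sum>j\<le>N. ?d j) \<le> (\<Sum>l. a (Suc l) + a l)" .
  qed auto
  with \<open>orthonormal_basis b\<close>
  show "\<exists>b. orthonormal_basis b \<and> summable (\<lambda>j. cmod (cinner (T (b j)) (b j)))"
    by blast
qed

end
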